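(* Let $\mathcal R\subset\mathbb R^J$ be non-empty and finite and let $\delta\ge 0$. The column-and-constraint generation algorithm (Algorithm 1) described in the context terminates in a finite number of steps with a feasible solution $\iota^\star\in\mathcal C^K$ to the problem $$(\widetilde{\mathcal P})\qquad \max_{\iota\in\mathcal C^K}\ \min_{s\in\{-1,1\}^K}\ \max_{x\in\mathcal R}\ \min_{u\in\widetilde{\mathcal U}_\Gamma(\iota,s)}u^\top x .$$ The objective value attained by this solution is within $\delta$ of the optimal objective value of $(\widetilde{\mathcal P})$.
   Context: Data: integers $I\ge 2$, $J,K\ge 1$; items $x^1,\dots,x^I\in\mathbb R^J$; a recommendation set $\mathcal R\subset\mathbb R^J$; $\mathcal U^0=\{u\in\mathbb R^J:Bu\ge b\}$ with $B\in\mathbb R^{N\times J}$, $b\in\mathbb R^N$, non-empty, full-dimensional and bounded; $\Gamma\ge 0$. Notation: $\mathcal K=\{1,\dots,K\}$; $\mathcal C=\{(i,i'):1\le i<i'\le I\}$; $\iota=(\iota^\kappa)_{\kappa}\in\mathcal C^K$, $\iota^\kappa=(\iota_1^\kappa,\iota_2^\kappa)$; $\mathcal E_\Gamma=\{\epsilon\in\mathbb R_+^K:\sum_\kappa\epsilon_\kappa\le\Gamma\}$; $\mathbf 1$ the all-ones vector. For $s\in\{-1,1\}^K$, $$\widetilde{\mathcal U}_\Gamma(\iota,s)=\{u\in\mathcal U^0:\exists\epsilon\in\mathcal E_\Gamma,\ s_\kappa u^\top(x^{\iota_1^\kappa}-x^{\iota_2^\kappa})\ge-\epsilon_\kappa\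 \forall\kappa\in\mathcal K\}.$$ $\max,\min$ denote suprema/infima in the extended reals; a minimum over $\emptyset$ is $+\infty$. Relaxed main problem $\mathrm{Main}(\mathcal S')$, for $\mathcal S'\subseteq\{-1,1\}^K$: maximize $\tau$ over $\tau\in\mathbb R$, $\iota\in\mathcal C^K$ and, for $s\in\mathcal S'$, $\alpha^s\in\mathbb R_+^K$, $\beta^s\in\mathbb R_+^N$, $\mu^s\in\mathbb R_-$, $x^s\in\mathcal R$, subject to, for all $s\in\mathcal S'$: $\tau\le b^\top\beta^s+\Gamma\mu^s$; $\sum_\kappa s_\kappa(x^{\iota_1^\kappa}-x^{\iota_2^\kappa})\alpha_\kappa^s+B^\top\beta^s=x^s$; $\alpha^s+\mu^s\mathbf 1\le 0$. Feasibility problem $\mathrm{Feas}(\iota)$: minimize $\theta$ over $\theta\in\mathbb R$, $s\in\{-1,1\}^K$, $u^x\in\mathcal U^0$, $\epsilon^x\in\mathcal E_\Gamma$ ($x\in\mathcal R$), subject to $\theta\ge(u^x)^\top x$ for all $x\in\mathcal R$ and, for all $\kappa\in\mathcal K$, $x\in\mathcal R$: $(u^x)^\top(x^{\iota_1^\kappa}-x^{\iota_2^\kappa})+\epsilon^x_\kappa\ge M(s_\kappa-1)$ and $(u^x)^\top(x^{\iota_1^\kappa}-x^{\iota_2^\kappa})-\epsilon^x_\kappa\le M(s_\kappa+1)$, where $M$ is a sufficiently large constant (large enough that the constraint with right-hand side $\mp 2M$ is implied by $u^x\in\mathcal U^0$ and $\epsilon^x\in\mathcal E_\Gamma$). Algorithm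 1. Input: tolerance $\delta$, $\mathcal C$, $\mathcal R$, $\mathcal U^0$, $K$. Initialize $\mathrm{UB}=+\infty$, $\mathrm{LB}=-\infty$, $\mathcal S'=\emptyset$. While $\mathrm{UB}-\mathrm{LB}>\delta$: (1) solve $\mathrm{Main}(\mathcal S')$; if solvable, let $(\tau,\iota,\dots)$ be an optimal solution; if unbounded, set $\tau=+\infty$ and let $\iota\in\mathcal C^K$ be such that $\mathrm{Main}(\mathcal S')$ is unbounded when the queries are fixed to $\iota$; set $\mathrm{UB}\leftarrow\tau$; (2) solve $\mathrm{Feas}(\iota)$, let $(\theta,\{u^x,\epsilon^x\}_{x\in\mathcal R},s)$ be an optimal solution and set $\mathrm{LB}\leftarrow\theta$; (3) if $\theta<\tau$, set $\mathcal S'\leftarrow\mathcal S'\cup\{s\}$. Upon exit from the loop return $\iota^\star=\iota$ (with objective value $\theta$). *)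

theory Defs
  imports "HOL-Analysis.Analysis"
begin

text \<open>
  The index types \<open>'j\<close>, \<open>'n\<close>, \<open>'k\<close> have \<open>J\<close>, \<open>N\<close>, \<open>K\<close> elements.
  Items are indexed by \<open>1, \<dots>, num_items D\<close>; values of \<open>item D\<close> elsewhere are irrelevant.
\<close>

record ('j, 'n) elicitation =
  num_items :: nat
  item :: "nat \<Rightarrow> real ^ 'j"
  recommendations :: "(real ^ 'j) set"
  cmat :: "real ^ 'j ^ 'n"
  crhs :: "real ^ 'n"
  budget :: real

type_synonym 'k queries = "'k \<Rightarrow> nat \<times> nat"

definition comparisons :: "('j::finite, 'n::finite) elicitation \<Rightarrow> (nat \<times> nat) set" where
  "comparisons D = {(i, i'). 1 \<le> i \<and> i < i' \<and> i' \<le> num_items D}"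

definition query_set :: "('j::finite, 'n::finite) elicitation \<Rightarrow> ('k::finite) queries set" where
  "query_set D = {\<iota>. \<forall>\<kappa>. \<iota> \<kappa> \<in> comparisons D}"

definition answers :: "(real ^ 'k) set" where
  "answers = {s. \<forall>\<kappa>. s $ \<kappa> \<in> {-1, 1}}"

definition qdiff :: "('j::finite, 'n::finite) elicitation \<Rightarrow> ('k::finite) queries \<Rightarrow> 'k \<Rightarrow> real ^ 'j" where
  "qdiff D \<iota> \<kappa> = item D (fst (\<iota> \<kappa>)) - item D (snd (\<iota> \<kappa>))"

definition U0 :: "('j::finite, 'n::finite) elicitation \<Rightarrow> (real ^ 'j) set" where
  "U0 D = {u. \<forall>n. (cmat D *v u) $ n \<ge> crhs D $ n}"

definition noise_set :: "('j::finite, 'n::finite) elicitation \<Rightarrow> (real ^ 'k) set" where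
  "noise_set D = {\<epsilon>. (\<forall>\<kappa>. 0 \<le> \<epsilon> $ \<kappa>) \<and> (\<Sum>\<kappa>\<in>UNIV. \<epsilon> $ \<kappa>) \<le> budget D}"

definition U_tilde ::
  "('j::finite, 'n::finite) elicitation \<Rightarrow> ('k::finite) queries \<Rightarrow> real ^ 'k \<Rightarrow> (real ^ 'j) set" where
  "U_tilde D \<iota> s =
     {u \<in> U0 D. \<exists>\<epsilon>\<in>noise_set D. \<forall>\<kappa>. s $ \<kappa> * (u \<bullet> qdiff D \<iota> \<kappa>) \<ge> - (\<epsilon> $ \<kappa>)}"

text \<open>Since values are extended reals, the infimum over an empty \<open>U_tilde D \<iota> s\<close> is \<open>\<infinity>\<close>.\<close>

definition objective :: "('j::finite, 'n::finite) elicitation \<Rightarrow> ('k::finite) queries \<Rightarrow> ereal" where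
  "objective D \<iota> =
     (INF s\<in>answers. SUP x\<in>recommendations D. INF u\<in>U_tilde D \<iota> s. ereal (u \<bullet> x))"

text \<open>
  The variables \<open>\<alpha>\<^sup>s, \<beta>\<^sup>s, \<mu>\<^sup>s, x\<^sup>s\<close> of the relaxed main problem are functions of \<open>s\<close>;
  their values for \<open>s \<notin> S\<close> are unconstrained and play no role.
\<close>

definition main_feasible ::
  "('j::finite, 'n::finite) elicitation \<Rightarrow> (real ^ 'k) set \<Rightarrow> real \<Rightarrow> ('k::finite) queries \<Rightarrow>
   (real ^ 'k \<Rightarrow> real ^ 'k) \<Rightarrow> (real ^ 'k \<Rightarrow> real ^ 'n) \<Rightarrow> (real ^ 'k \<Rightarrow> real) \<Rightarrow>
   (real ^ 'k \<Rightarrow> real ^ 'j) \<Rightarrow> bool" where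
  "main_feasible D S \<tau> \<iota> \<alpha> \<beta> \<mu> x \<longleftrightarrow>
     \<iota> \<in> query_set D \<and>
     (\<forall>s\<in>S.
        (\<forall>\<kappa>. 0 \<le> \<alpha> s $ \<kappa>) \<and> (\<forall>n. 0 \<le> \<beta> s $ n) \<and> \<mu> s \<le> 0 \<and> x s \<in> recommendations D \<and>
        \<tau> \<le> crhs D \<bullet> \<beta> s + budget D * \<mu> s \<and>
        (\<Sum>\<kappa>\<in>UNIV. (s $ \<kappa> * \<alpha> s $ \<kappa>) *\<^sub>R qdiff D \<iota> \<kappa>) + transpose (cmat D) *v \<beta> s = x s \<and>
        (\<forall>\<kappa>. \<alpha> s $ \<kappa> + \<mu> s \<le> 0))"

definition main_optimal ::
  "('j::finite, 'n::finite) elicitation \<Rightarrow> (real ^ 'k) set \<Rightarrow> real \<Rightarrow> ('k::finite) queries \<Rightarrow>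
   (real ^ 'k \<Rightarrow> real ^ 'k) \<Rightarrow> (real ^ 'k \<Rightarrow> real ^ 'n) \<Rightarrow> (real ^ 'k \<Rightarrow> real) \<Rightarrow>
   (real ^ 'k \<Rightarrow> real ^ 'j) \<Rightarrow> bool" where
  "main_optimal D S \<tau> \<iota> \<alpha> \<beta> \<mu> x \<longleftrightarrow>
     main_feasible D S \<tau> \<iota> \<alpha> \<beta> \<mu> x \<and>
     (\<forall>\<tau>' \<iota>' \<alpha>' \<beta>' \<mu>' x'. main_feasible D S \<tau>' \<iota>' \<alpha>' \<beta>' \<mu>' x' \<longrightarrow> \<tau>' \<le> \<tau>)"

definition main_unbounded ::
  "('j::finite, 'n::finite) elicitation \<Rightarrow> (real ^ 'k::finite) set \<Rightarrow> bool" where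
  "main_unbounded D S \<longleftrightarrow>
     (\<forall>r. \<exists>\<tau> \<iota> \<alpha> \<beta> \<mu> x. main_feasible D S \<tau> \<iota> \<alpha> \<beta> \<mu> x \<and> r \<le> \<tau>)"

definition main_unbounded_at ::
  "('j::finite, 'n::finite) elicitation \<Rightarrow> (real ^ 'k) set \<Rightarrow> ('k::finite) queries \<Rightarrow> bool" where
  "main_unbounded_at D S \<iota> \<longleftrightarrow>
     (\<forall>r. \<exists>\<tau> \<alpha> \<beta> \<mu> x. main_feasible D S \<tau> \<iota> \<alpha> \<beta> \<mu> x \<and> r \<le> \<tau>)"

inductive main_result ::
  "('j::finite, 'n::finite) elicitation \<Rightarrow> (real ^ 'k) set \<Rightarrow> ereal \<Rightarrow> ('k::finite) queries \<Rightarrow> bool"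
  for D S where
  solvable: "main_optimal D S \<tau> \<iota> \<alpha> \<beta> \<mu> x \<Longrightarrow> main_result D S (ereal \<tau>) \<iota>"
| unbounded:
    "main_unbounded D S \<Longrightarrow> \<iota> \<in> query_set D \<Longrightarrow> main_unbounded_at D S \<iota> \<Longrightarrow> main_result D S \<infinity> \<iota>"

text \<open>
  Likewise, \<open>u\<close> and \<open>\<epsilon>\<close> in the feasibility problem are families indexed by the
  recommendations; their values elsewhere are unconstrained.
\<close>

definition feas_feasible ::
  "('j::finite, 'n::finite) elicitation \<Rightarrow> real \<Rightarrow> ('k::finite) queries \<Rightarrow> real \<Rightarrow> real ^ 'k \<Rightarrow>
   (real ^ 'j \<Rightarrow> real ^ 'j) \<Rightarrow> (real ^ 'j \<Rightarrow> real ^ 'k) \<Rightarrow> bool" where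
  "feas_feasible D M \<iota> \<theta> s u \<epsilon> \<longleftrightarrow>
     s \<in> answers \<and>
     (\<forall>x\<in>recommendations D.
        u x \<in> U0 D \<and> \<epsilon> x \<in> noise_set D \<and> \<theta> \<ge> u x \<bullet> x \<and>
        (\<forall>\<kappa>. u x \<bullet> qdiff D \<iota> \<kappa> + \<epsilon> x $ \<kappa> \<ge> M * (s $ \<kappa> - 1) \<and>
             u x \<bullet> qdiff D \<iota> \<kappa> - \<epsilon> x $ \<kappa> \<le> M * (s $ \<kappa> + 1)))"

definition feas_optimal ::
  "('j::finite, 'n::finite) elicitation \<Rightarrow> real \<Rightarrow> ('k::finite) queries \<Rightarrow> real \<Rightarrow> real ^ 'k \<Rightarrow>
   (real ^ 'j \<Rightarrow> real ^ 'j) \<Rightarrow> (real ^ 'j \<Rightarrow> real ^ 'k) \<Rightarrow> bool" where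
  "feas_optimal D M \<iota> \<theta> s u \<epsilon> \<longleftrightarrow>
     feas_feasible D M \<iota> \<theta> s u \<epsilon> \<and>
     (\<forall>\<theta>' s' u' \<epsilon>'. feas_feasible D M \<iota> \<theta>' s' u' \<epsilon>' \<longrightarrow> \<theta> \<le> \<theta>')"

text \<open>\<open>M\<close> is large enough that the constraints with right-hand side \<open>-2M\<close> and \<open>2M\<close> are redundant.\<close>

definition big_M ::
  "('j::finite, 'n::finite) elicitation \<Rightarrow> ('k::finite) queries \<Rightarrow> real \<Rightarrow> bool" where
  "big_M D \<iota> M \<longleftrightarrow>
     (\<forall>u\<in>U0 D. \<forall>\<epsilon>\<in>noise_set D. \<forall>\<kappa>.
        u \<bullet> qdiff D \<iota> \<kappa> + \<epsilon> $ \<kappa> \<ge> - 2 * M \<and> u \<bullet> qdiff D \<iota> \<kappa> - \<epsilon> $ \<kappa> \<le> 2 * M)"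

text \<open>
  The algorithm is a nondeterministic transition system, because the optimal solutions of the
  two subproblems (and the queries chosen in the unbounded case) need not be unique.
  \<open>Loop_Head UB LB S inc\<close> is the state before the test of the while loop, where \<open>inc\<close> holds
  the current queries and their \<open>\<theta>\<close> once an iteration has been completed;
  \<open>Main_Solved UB LB S \<iota>\<close> is the state between solving the main problem and solving the
  feasibility problem. If a subproblem had neither an optimal solution nor (for the main
  problem) an unbounded outcome, the system would be stuck in a state other than \<open>Returned\<close>.
\<close>

datatype 'k alg_state =
    Loop_Head ereal ereal "(real ^ 'k) set" "('k queries \<times> real) option"
  | Main_Solved ereal ereal "(real ^ 'k) set" "'k queries"
  | Returned "'k queries" real

definition alg_init :: "('k::finite) alg_state" where
  "alg_init = Loop_Head \<infinity> (-\<infinity>) {} None"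

inductive alg_step ::
  "('j::finite, 'n::finite) elicitation \<Rightarrow> real \<Rightarrow> real \<Rightarrow>
   ('k::finite) alg_state \<Rightarrow> 'k alg_state \<Rightarrow> bool"
  for D M \<delta> where
  solve_main:
    "UB - LB > ereal \<delta> \<Longrightarrow> main_result D S \<tau> \<iota> \<Longrightarrow>
     alg_step D M \<delta> (Loop_Head UB LB S inc) (Main_Solved \<tau> LB S \<iota>)"
| solve_feas:
    "feas_optimal D M \<iota> \<theta> s u \<epsilon> \<Longrightarrow>
     alg_step D M \<delta> (Main_Solved \<tau> LB S \<iota>)
       (Loop_Head \<tau> (ereal \<theta>) (if ereal \<theta> < \<tau> then insert s S else S) (Some (\<iota>, \<theta>)))"
| exit_loop:
    "\<not> UB - LB > ereal \<delta> \<Longrightarrow>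
     alg_step D M \<delta> (Loop_Head UB LB S (Some (\<iota>, \<theta>))) (Returned \<iota> \<theta>)"

end

theory Submission
  imports Defs
begin

text \<open>
  For fixed queries and answers, linear programming duality identifies the largest feasible
  \<open>\<tau>\<close> of the relaxed main problem with the inner max-min value. Hence \<open>UB\<close> always dominates the
  optimum, while \<open>LB\<close> is the exact value of the current queries. If \<open>\<theta> < \<tau>\<close>, the worst-case answer
  vector \<open>s\<close> violates a bound that all members of \<open>S\<close> satisfy, so \<open>s\<close> is new; since there are only
  finitely many answer vectors, the loop ends.
\<close>

subsection \<open>Linear programming duality\<close>

text \<open>The obstacle is infinite values. If no utility explains the answers,
  \<open>U_tilde D \<iota> s\<close> is empty and the inner minimum is \<infinity>; the dual
  program, and with it the main problem, may then have no optimal solution. Duality is therefore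
  stated level by level: a real \<open>r\<close> is feasible for the dual iff \<open>ereal r\<close>
  is at most the value. In this form the solvable and the unbounded outcome of the main problem
  become one case. Boundedness of \<open>U0 D\<close> enters because an empty primal could otherwise
  come with an infeasible dual. The feasibility problem is the mirror image, described by the reals
  above the value. It needs the inner minimum to be attained, by compactness, and the optimum to be
  finite: the noise-free answers of any single utility in \<open>U0 D\<close> keep
  \<open>U_tilde\<close> non-empty.\<close>

text \<open>A finitely generated cone is closed, so a vector outside it can be strictly separated
  from it, and the normal of the separating hyperplane is a \<open>y\<close> that contradicts the
  assumption.\<close>

lemma farkas:
  fixes f :: "'i::finite \<Rightarrow> 'a::euclidean_space"
  assumes "\<And>y. (\<And>i. 0 \<le> f i \<bullet> y) \<Longrightarrow> 0 \<le> c \<bullet> y"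
  obtains w where "\<And>i. 0 \<le> w i" "c = (\<Sum>i\<in>UNIV. w i *\<^sub>R f i)"
proof -
  let ?C = "convex_cone hull (range f)"
  have "c \<in> ?C"
  proof (rule ccontr)
    assume "c \<notin> ?C"
    moreover have "closed ?C"
      by (simp add: closed_convex_cone_hull)
    ultimately obtain a b where ab: "a \<bullet> c < b" "\<forall>x\<in>?C. b < a \<bullet> x"
      using separating_hyperplane_closed_point[of ?C c] convex_convex_cone_hull by blast
    have "b < 0"
      using ab(2) convex_cone_hull_contains_0 by fastforce
    have "0 \<le> f i \<bullet> a" for i
    proof (rule ccontr)
      assume neg: "\<not> 0 \<le> f i \<bullet> a"
      \<comment> \<open>The factor is non-negative, both numbers being negative, and makes the inner
        product with \<open>a\<close> exactly \<open>b\<close>, which strict separation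
        forbids.\<close>
      have "(b / (f i \<bullet> a)) *\<^sub>R f i \<in> ?C"
        using neg \<open>b < 0\<close> by (intro convex_cone_hull_mul hull_inc) (auto simp: divide_nonpos_neg)
      with ab(2) have "b < (b / (f i \<bullet> a)) * (a \<bullet> f i)"
        by fastforce
      with neg show False
        by (simp add: inner_commute)
    qed
    then have "0 \<le> c \<bullet> a"
      by (rule assms)
    with ab(1) \<open>b < 0\<close> show False
      by (simp add: inner_commute)
  qed
  moreover have "?C \<subseteq> {x. \<exists>w. (\<forall>i. 0 \<le> w i) \<and> x = (\<Sum>i\<in>UNIV. w i *\<^sub>R f i)}" (is "_ \<subseteq> ?W")
  proof (rule hull_minimal)
    show "range f \<subseteq> ?W"
    proof clarify
      fix j
      have "f j = (\<Sum>i\<in>UNIV. (if i = j then 1 else 0) *\<^sub>R f i)"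
        by (simp add: if_distrib[of "\<lambda>r. r *\<^sub>R _"] cong: if_cong)
      then show "\<exists>w. (\<forall>i. 0 \<le> w i) \<and> f j = (\<Sum>i\<in>UNIV. w i *\<^sub>R f i)"
        by (intro exI[of _ "\<lambda>i. if i = j then 1 else 0"]) simp
    qed
    show "convex_cone ?W"
      unfolding convex_cone_iff
    proof (intro conjI ballI allI impI)
      show "0 \<in> ?W"
        by (auto intro!: exI[of _ "\<lambda>i. 0"])
    next
      fix x y assume "x \<in> ?W" "y \<in> ?W"
      then obtain v w where "\<forall>i. 0 \<le> v i" "\<forall>i. 0 \<le> w i"
        "x = (\<Sum>i\<in>UNIV. v i *\<^sub>R f i)" "y = (\<Sum>i\<in>UNIV. w i *\<^sub>R f i)"
        by blast
      then show "x + y \<in> ?W"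
        by (auto intro!: exI[of _ "\<lambda>i. v i + w i"] simp: sum.distrib scaleR_left_distrib)
    next
      fix x and r :: real assume "x \<in> ?W" "0 \<le> r"
      then obtain v where "\<forall>i. 0 \<le> v i" "x = (\<Sum>i\<in>UNIV. v i *\<^sub>R f i)"
        by blast
      with \<open>0 \<le> r\<close> show "r *\<^sub>R x \<in> ?W"
        by (auto intro!: exI[of _ "\<lambda>i. r * v i"] simp: scaleR_sum_right)
    qed
  qed
  ultimately show ?thesis
    using that by blast
qed

text \<open>The block of the main problem that belongs to one \<open>s\<close>: the linear
  programming dual of minimising \<open>u \<bullet> x\<close> over
  \<open>U_tilde D \<iota> s\<close>, at level \<open>\<tau>\<close>. Different blocks share only
  \<open>\<tau>\<close> and \<open>\<iota>\<close>.\<close>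

definition dual_feasible ::
  "('j::finite, 'n::finite) elicitation \<Rightarrow> ('k::finite) queries \<Rightarrow> real ^ 'k \<Rightarrow> real \<Rightarrow>
   real ^ 'k \<Rightarrow> real ^ 'n \<Rightarrow> real \<Rightarrow> real ^ 'j \<Rightarrow> bool" where
  "dual_feasible D \<iota> s \<tau> \<alpha> \<beta> \<mu> x \<longleftrightarrow>
     (\<forall>\<kappa>. 0 \<le> \<alpha> $ \<kappa>) \<and> (\<forall>n. 0 \<le> \<beta> $ n) \<and> \<mu> \<le> 0 \<and> x \<in> recommendations D \<and>
     \<tau> \<le> crhs D \<bullet> \<beta> + budget D * \<mu> \<and>
     (\<Sum>\<kappa>\<in>UNIV. (s $ \<kappa> * \<alpha> $ \<kappa>) *\<^sub>R qdiff D \<iota> \<kappa>) + transpose (cmat D) *v \<beta> = x \<and>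
     (\<forall>\<kappa>. \<alpha> $ \<kappa> + \<mu> \<le> 0)"

lemma main_feasible_iff_dual_feasible:
  "main_feasible D S \<tau> \<iota> \<alpha> \<beta> \<mu> x \<longleftrightarrow>
     \<iota> \<in> query_set D \<and> (\<forall>s\<in>S. dual_feasible D \<iota> s \<tau> (\<alpha> s) (\<beta> s) (\<mu> s) (x s))"
  by (simp add: main_feasible_def dual_feasible_def)

text \<open>Weak duality: the constraints on \<open>u\<close> are weighted with
  \<open>\<alpha>\<close> and \<open>\<beta>\<close> and added. The noise costs at most
  \<open>budget D * (- \<mu>)\<close>, because every \<open>\<alpha> $ \<kappa>\<close> is at most
  \<open>- \<mu>\<close>.\<close>

lemma dual_feasible_le:
  assumes dual: "dual_feasible D \<iota> s \<tau> \<alpha> \<beta> \<mu> x" and u: "u \<in> U_tilde D \<iota> s"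
  shows "\<tau> \<le> u \<bullet> x"
proof -
  obtain \<epsilon> where \<epsilon>: "\<And>\<kappa>. 0 \<le> \<epsilon> $ \<kappa>" "(\<Sum>\<kappa>\<in>UNIV. \<epsilon> $ \<kappa>) \<le> budget D"
      "\<And>\<kappa>. - (\<epsilon> $ \<kappa>) \<le> s $ \<kappa> * (u \<bullet> qdiff D \<iota> \<kappa>)"
    and B: "\<And>n. crhs D $ n \<le> (cmat D *v u) $ n"
    using u unfolding U_tilde_def U0_def noise_set_def by blast
  have \<alpha>: "\<And>\<kappa>. 0 \<le> \<alpha> $ \<kappa>" "\<And>\<kappa>. \<alpha> $ \<kappa> \<le> - \<mu>" and \<beta>: "\<And>n. 0 \<le> \<beta> $ n" and \<mu>: "\<mu> \<le> 0"
    using dual unfolding dual_feasible_def by (auto simp: algebra_simps) (smt (verit))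
  have "budget D * \<mu> \<le> (\<Sum>\<kappa>\<in>UNIV. \<epsilon> $ \<kappa>) * \<mu>"
    using \<epsilon>(2) \<mu> by (simp add: mult_right_mono_neg)
  also have "\<dots> \<le> (\<Sum>\<kappa>\<in>UNIV. - (\<alpha> $ \<kappa> * \<epsilon> $ \<kappa>))"
    unfolding sum_distrib_right
  proof (rule sum_mono)
    fix \<kappa>
    show "\<epsilon> $ \<kappa> * \<mu> \<le> - (\<alpha> $ \<kappa> * \<epsilon> $ \<kappa>)"
      using mult_right_mono[OF \<alpha>(2) \<epsilon>(1), of \<kappa> \<kappa>] by (simp add: mult.commute)
  qed
  also have "\<dots> \<le> (\<Sum>\<kappa>\<in>UNIV. (s $ \<kappa> * \<alpha> $ \<kappa>) * (u \<bullet> qdiff D \<iota> \<kappa>))"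
  proof (rule sum_mono)
    fix \<kappa>
    show "- (\<alpha> $ \<kappa> * \<epsilon> $ \<kappa>) \<le> (s $ \<kappa> * \<alpha> $ \<kappa>) * (u \<bullet> qdiff D \<iota> \<kappa>)"
      using mult_left_mono[OF \<epsilon>(3) \<alpha>(1), of \<kappa> \<kappa>] by (simp add: mult_ac)
  qed
  finally have "budget D * \<mu> \<le> u \<bullet> (\<Sum>\<kappa>\<in>UNIV. (s $ \<kappa> * \<alpha> $ \<kappa>) *\<^sub>R qdiff D \<iota> \<kappa>)"
    by (simp add: inner_sum_right)
  moreover have "crhs D \<bullet> \<beta> \<le> (cmat D *v u) \<bullet> \<beta>"
    unfolding inner_vec_def using B \<beta> by (auto intro!: sum_mono mult_right_mono)
  moreover have "(cmat D *v u) \<bullet> \<beta> = u \<bullet> (transpose (cmat D) *v \<beta>)"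
    by (simp add: dot_lmul_matrix[symmetric] inner_commute)
  moreover have "u \<bullet> x = u \<bullet> (\<Sum>\<kappa>\<in>UNIV. (s $ \<kappa> * \<alpha> $ \<kappa>) *\<^sub>R qdiff D \<iota> \<kappa>) + u \<bullet> (transpose (cmat D) *v \<beta>)"
    using dual unfolding dual_feasible_def by (metis inner_right_distrib)
  moreover have "\<tau> \<le> crhs D \<bullet> \<beta> + budget D * \<mu>"
    using dual by (simp add: dual_feasible_def)
  ultimately show ?thesis
    by linarith
qed

lemma bounded_U0_recession:
  assumes "U0 D \<noteq> {}" "bounded (U0 D)" and v: "\<And>n. 0 \<le> (cmat D *v v) $ n"
  shows "v = 0"
proof (rule ccontr)
  assume "v \<noteq> 0"
  obtain u where u: "u \<in> U0 D"
    using assms(1) by blast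
  obtain B where B: "\<And>w. w \<in> U0 D \<Longrightarrow> norm w \<le> B"
    using assms(2) unfolding bounded_iff by blast
  \<comment> \<open>With this length the step \<open>t *\<^sub>R v\<close> from \<open>u\<close>
    overshoots the bound \<open>B\<close> by one, even after the triangle inequality has cost
    \<open>norm u\<close>.\<close>
  define t where "t = (B + norm u + 1) / norm v"
  have "0 \<le> B"
    using B[OF u] norm_ge_zero order_trans by blast
  then have "0 \<le> t"
    by (simp add: t_def)
  then have "u + t *\<^sub>R v \<in> U0 D"
    using u v by (auto simp: U0_def matrix_vector_right_distrib matrix_vector_mult_scaleR
        intro: add_increasing2)
  then have "norm (u + t *\<^sub>R v) \<le> B"
    by (rule B)
  moreover have "norm (t *\<^sub>R v) = B + norm u + 1"
    using \<open>0 \<le> t\<close> \<open>0 \<le> B\<close> \<open>v \<noteq> 0\<close> by (simp add: t_def)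
  moreover have "norm (t *\<^sub>R v) \<le> norm (u + t *\<^sub>R v) + norm u"
    by (metis add_diff_cancel_left' norm_triangle_ineq4)
  ultimately show False
    by simp
qed

lemma sum_UNIV_Plus:
  fixes g :: "'a::finite + 'b::finite \<Rightarrow> 'c::comm_monoid_add"
  shows "sum g UNIV = (\<Sum>a\<in>UNIV. g (Inl a)) + (\<Sum>b\<in>UNIV. g (Inr b))"
  using sum.Plus[of UNIV UNIV g] by simp

locale bounded_elicitation =
  fixes D :: "('j::finite, 'n::finite) elicitation"
  assumes U0_nonempty: "U0 D \<noteq> {}" and U0_bounded: "bounded (U0 D)"
    and budget_nonneg: "0 \<le> budget D"
    and recommendations_nonempty: "recommendations D \<noteq> {}"
    and recommendations_finite: "finite (recommendations D)"
begin

text \<open>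
  Farkas' lemma is applied to the homogenised system in \<open>(u, \<epsilon>, t)\<close> with \<open>t \<ge> 0\<close>. Its solutions with
  \<open>t = 0\<close> have \<open>u = 0\<close> because \<open>U0 D\<close> is bounded, so \<open>U_tilde D \<iota> s\<close> may be empty.
\<close>

lemma dual_feasible_exists:
  fixes \<iota> :: "('k::finite) queries"
  assumes x: "x \<in> recommendations D" and r: "\<And>u. u \<in> U_tilde D \<iota> s \<Longrightarrow> r \<le> u \<bullet> x"
  shows "\<exists>\<alpha> \<beta> \<mu>. dual_feasible D \<iota> s r \<alpha> \<beta> \<mu> x"
proof -
  \<comment> \<open>One vector per homogenised constraint on \<open>(u, \<epsilon>, t)\<close>: the
    rows of \<open>U0\<close>, the answers, \<open>\<epsilon> \<ge> 0\<close>, the budget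
    (\<open>True\<close>) and \<open>t \<ge> 0\<close> (\<open>False\<close>). The target
    \<open>(x, 0, - r)\<close> expresses \<open>u \<bullet> x \<ge> r * t\<close>.\<close>
  define f :: "'n + 'k + 'k + bool \<Rightarrow> (real ^ 'j) \<times> (real ^ 'k) \<times> real" where
    "f = case_sum (\<lambda>n. (cmat D $ n, 0, - crhs D $ n))
        (case_sum (\<lambda>\<kappa>. (s $ \<kappa> *\<^sub>R qdiff D \<iota> \<kappa>, axis \<kappa> 1, 0))
          (case_sum (\<lambda>\<kappa>. (0, axis \<kappa> 1, 0))
            (\<lambda>b. if b then (0, - 1, budget D) else (0, 0, 1))))"
  have "0 \<le> (x, 0, - r) \<bullet> y" if f_nonneg: "\<And>i. 0 \<le> f i \<bullet> y" for y
  proof -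
    obtain u \<epsilon> t where y: "y = (u, \<epsilon>, t)"
      by (cases y)
    have B: "crhs D $ n * t \<le> (cmat D *v u) $ n" for n
      using f_nonneg[of "Inl n"] by (simp add: f_def y matrix_vector_mul_component)
    have d: "- (\<epsilon> $ \<kappa>) \<le> s $ \<kappa> * (u \<bullet> qdiff D \<iota> \<kappa>)" for \<kappa>
      using f_nonneg[of "Inr (Inl \<kappa>)"] by (simp add: f_def y inner_axis inner_axis' inner_commute)
    have \<epsilon>: "0 \<le> \<epsilon> $ \<kappa>" for \<kappa>
      using f_nonneg[of "Inr (Inr (Inl \<kappa>))"] by (simp add: f_def y inner_axis')
    have \<Gamma>: "(\<Sum>\<kappa>\<in>UNIV. \<epsilon> $ \<kappa>) \<le> budget D * t"
      using f_nonneg[of "Inr (Inr (Inr True))"] by (simp add: f_def y inner_vec_def sum_negf)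
    have "0 \<le> t"
      using f_nonneg[of "Inr (Inr (Inr False))"] by (simp add: f_def y)
    show ?thesis
    proof (cases "t = 0")
      case True
      with B have "u = 0"
        using bounded_U0_recession[OF U0_nonempty U0_bounded] by simp
      with True show ?thesis
        by (simp add: y)
    next
      case False
      with \<open>0 \<le> t\<close> have "0 < t"
        by simp
      have "(1 / t) *\<^sub>R u \<in> U0 D"
        using B \<open>0 < t\<close> by (simp add: U0_def matrix_vector_mult_scaleR field_simps)
      moreover have "(1 / t) *\<^sub>R \<epsilon> \<in> noise_set D"
        using \<epsilon> \<Gamma> \<open>0 < t\<close> by (simp add: noise_set_def sum_divide_distrib[symmetric] field_simps)
      moreover have "- (((1 / t) *\<^sub>R \<epsilon>) $ \<kappa>) \<le> s $ \<kappa> * (((1 / t) *\<^sub>R u) \<bullet> qdiff D \<iota> \<kappa>)" for \<kappa>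
        using divide_right_mono[OF d \<open>0 \<le> t\<close>, of \<kappa>] by simp
      ultimately have "(1 / t) *\<^sub>R u \<in> U_tilde D \<iota> s"
        unfolding U_tilde_def by blast
      from r[OF this] \<open>0 < t\<close> show ?thesis
        by (simp add: y field_simps inner_commute)
    qed
  qed
  then obtain w where w: "\<And>i. 0 \<le> w i" and sum_w: "(x, 0, - r) = (\<Sum>i\<in>UNIV. w i *\<^sub>R f i)"
    using farkas[of f "(x, 0, - r)"] by blast
  define \<alpha> :: "real ^ 'k" where "\<alpha> = (\<chi> \<kappa>. w (Inr (Inl \<kappa>)))"
  define \<beta> :: "real ^ 'n" where "\<beta> = (\<chi> n. w (Inl n))"
  \<comment> \<open>\<open>\<gamma>\<close> and, below, \<open>p\<close> are the multipliers of
    \<open>\<epsilon> \<ge> 0\<close> and \<open>t \<ge> 0\<close>. They are the slacks in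
    \<open>\<alpha> $ \<kappa> + \<mu> \<le> 0\<close> and
    \<open>r \<le> crhs D \<bullet> \<beta> + budget D * \<mu>\<close>.\<close>
  define \<gamma> :: "real ^ 'k" where "\<gamma> = (\<chi> \<kappa>. w (Inr (Inr (Inl \<kappa>))))"
  define \<mu> where "\<mu> = - w (Inr (Inr (Inr True)))"
  define p where "p = w (Inr (Inr (Inr False)))"
  have sum_eq: "(x, 0 :: real ^ 'k, - r) =
      (\<Sum>n\<in>UNIV. \<beta> $ n *\<^sub>R (cmat D $ n, 0, - crhs D $ n)) +
      ((\<Sum>\<kappa>\<in>UNIV. \<alpha> $ \<kappa> *\<^sub>R (s $ \<kappa> *\<^sub>R qdiff D \<iota> \<kappa>, axis \<kappa> 1, 0)) +
       ((\<Sum>\<kappa>\<in>UNIV. \<gamma> $ \<kappa> *\<^sub>R (0, axis \<kappa> 1, 0)) +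
        (- \<mu> *\<^sub>R (0, - 1, budget D) + p *\<^sub>R (0, 0, 1))))"
    unfolding sum_w sum_UNIV_Plus
    by (simp add: f_def \<alpha>_def \<beta>_def \<gamma>_def \<mu>_def p_def UNIV_bool add.commute)
  have "x = (\<Sum>n\<in>UNIV. \<beta> $ n *\<^sub>R cmat D $ n) + (\<Sum>\<kappa>\<in>UNIV. (s $ \<kappa> * \<alpha> $ \<kappa>) *\<^sub>R qdiff D \<iota> \<kappa>)"
    using arg_cong[OF sum_eq, of fst] by (simp add: fst_sum mult.commute)
  moreover have "(\<Sum>n\<in>UNIV. \<beta> $ n *\<^sub>R cmat D $ n) = transpose (cmat D) *v \<beta>"
    by (simp add: vec_eq_iff matrix_vector_mult_def transpose_def mult.commute)
  moreover have "\<alpha> $ \<kappa> + \<gamma> $ \<kappa> + \<mu> = 0" for \<kappa>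
  proof -
    have "0 = (\<Sum>\<kappa>\<in>UNIV. \<alpha> $ \<kappa> *\<^sub>R axis \<kappa> 1) + ((\<Sum>\<kappa>\<in>UNIV. \<gamma> $ \<kappa> *\<^sub>R axis \<kappa> 1) + \<mu> *\<^sub>R (1 :: real ^ 'k))"
      using arg_cong[OF sum_eq, of "\<lambda>z. fst (snd z)"] by (simp add: fst_sum snd_sum)
    then have "0 = \<alpha> + (\<gamma> + \<mu> *\<^sub>R (1 :: real ^ 'k))"
      using basis_expansion[of \<alpha>] basis_expansion[of \<gamma>] by (simp add: scalar_mult_eq_scaleR)
    then show ?thesis
      by (auto dest: arg_cong[of _ _ "\<lambda>v. v $ \<kappa>"])
  qed
  moreover have "- r = - (crhs D \<bullet> \<beta>) - budget D * \<mu> + p"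
    using arg_cong[OF sum_eq, of "\<lambda>z. snd (snd z)"]
    by (simp add: snd_sum inner_vec_def sum_negf mult.commute)
  moreover have "\<And>\<kappa>. 0 \<le> \<alpha> $ \<kappa>" "\<And>\<kappa>. 0 \<le> \<gamma> $ \<kappa>" "\<And>n. 0 \<le> \<beta> $ n" "\<mu> \<le> 0" "0 \<le> p"
    using w by (simp_all add: \<alpha>_def \<beta>_def \<gamma>_def \<mu>_def p_def)
  ultimately have "dual_feasible D \<iota> s r \<alpha> \<beta> \<mu> x"
    unfolding dual_feasible_def using x by (smt (verit) add.commute)
  then show ?thesis
    by blast
qed

end

subsection \<open>The values of the subproblems\<close>

definition robust_value :: "('j::finite, 'n::finite) elicitation \<Rightarrow> ('k::finite) queries \<Rightarrow> real ^ 'k \<Rightarrow> ereal" where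
  "robust_value D \<iota> s = (SUP x\<in>recommendations D. INF u\<in>U_tilde D \<iota> s. ereal (u \<bullet> x))"

lemma objective_eq_robust_value: "objective D \<iota> = (INF s\<in>answers. robust_value D \<iota> s)"
  by (simp add: objective_def robust_value_def)

lemma finite_answers: "finite (answers :: (real ^ 'k::finite) set)"
proof (rule finite_subset)
  show "(answers :: (real ^ 'k) set) \<subseteq> vec_lambda ` (UNIV \<rightarrow>\<^sub>E {-1, 1 :: real})"
  proof
    fix s :: "real ^ 'k" assume "s \<in> answers"
    then have "($) s \<in> UNIV \<rightarrow>\<^sub>E {-1, 1}"
      by (auto simp: answers_def)
    then show "s \<in> vec_lambda ` (UNIV \<rightarrow>\<^sub>E {-1, 1})"
      by (metis image_eqI vec_nth_inverse)
  qed
qed (simp add: finite_PiE)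

lemma finite_query_set: "finite (query_set D :: ('k::finite) queries set)"
proof (rule finite_subset)
  show "(query_set D :: 'k queries set) \<subseteq> (UNIV \<rightarrow>\<^sub>E {..num_items D} \<times> {..num_items D})"
  proof
    fix \<iota> :: "'k queries" assume \<iota>: "\<iota> \<in> query_set D"
    have "\<iota> \<kappa> \<in> {..num_items D} \<times> {..num_items D}" for \<kappa>
    proof -
      have "\<iota> \<kappa> \<in> comparisons D"
        using \<iota> by (simp add: query_set_def)
      then show ?thesis
        by (auto simp: comparisons_def)
    qed
    then show "\<iota> \<in> UNIV \<rightarrow>\<^sub>E {..num_items D} \<times> {..num_items D}"
      by blast
  qed
qed (simp add: finite_PiE)

lemma query_set_nonempty:
  assumes "2 \<le> num_items D"
  shows "query_set D \<noteq> {}"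
proof -
  have "(\<lambda>\<kappa>. (1, 2)) \<in> query_set D"
    using assms by (simp add: query_set_def comparisons_def)
  then show ?thesis
    by blast
qed

lemma finite_INF_attained:
  fixes f :: "'a \<Rightarrow> 'b::{complete_linorder}"
  assumes "finite A" "A \<noteq> {}"
  obtains a where "a \<in> A" "f a = (INF x\<in>A. f x)"
proof -
  have "Min (f ` A) \<in> f ` A"
    using assms by (intro Min_in) auto
  then obtain a where "a \<in> A" "f a = Min (f ` A)"
    by auto
  with that show ?thesis
    using assms by (simp add: Min_Inf)
qed

lemma finite_SUP_attained:
  fixes f :: "'a \<Rightarrow> 'b::{complete_linorder}"
  assumes "finite A" "A \<noteq> {}"
  obtains a where "a \<in> A" "f a = (SUP x\<in>A. f x)"
proof -
  have "Max (f ` A) \<in> f ` A"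
    using assms by (intro Max_in) auto
  then obtain a where "a \<in> A" "f a = Max (f ` A)"
    by auto
  with that show ?thesis
    using assms by (simp add: Max_Sup)
qed

text \<open>The reals are dense in the extended reals. This passes from feasible levels, which are
  real, to values, which may be infinite.\<close>

lemma ereal_le_iff_real_le:
  fixes a b :: ereal
  shows "a \<le> b \<longleftrightarrow> (\<forall>r. ereal r \<le> a \<longrightarrow> ereal r \<le> b)"
proof
  assume *: "\<forall>r. ereal r \<le> a \<longrightarrow> ereal r \<le> b"
  show "a \<le> b"
  proof (rule ccontr)
    assume "\<not> a \<le> b"
    then have "b < a"
      by simp
    then obtain r where "b < ereal r" "ereal r < a"
      using ereal_dense2 by blast
    with * show False
      by (metis less_imp_le not_le)
  qed
qed (use order_trans in blast)

context bounded_elicitation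
begin

text \<open>Weak and strong duality combined, with the recommendation now also chosen by the
  dual.\<close>

lemma dual_feasible_iff:
  "(\<exists>\<alpha> \<beta> \<mu> x. dual_feasible D \<iota> s r \<alpha> \<beta> \<mu> x) \<longleftrightarrow> ereal r \<le> robust_value D \<iota> s"
proof
  assume "\<exists>\<alpha> \<beta> \<mu> x. dual_feasible D \<iota> s r \<alpha> \<beta> \<mu> x"
  then obtain \<alpha> \<beta> \<mu> x where dual: "dual_feasible D \<iota> s r \<alpha> \<beta> \<mu> x"
    by blast
  then have "x \<in> recommendations D"
    by (simp add: dual_feasible_def)
  then show "ereal r \<le> robust_value D \<iota> s"
    unfolding robust_value_def
    by (rule SUP_upper2) (use dual_feasible_le[OF dual] in \<open>auto intro: INF_greatest\<close>)
next
  assume *: "ereal r \<le> robust_value D \<iota> s"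
  \<comment> \<open>Finiteness lets one recommendation attain the supremum, so that it certifies
    \<open>r\<close> even when \<open>r\<close> equals the value.\<close>
  obtain x where x: "x \<in> recommendations D"
    and eq: "(INF u\<in>U_tilde D \<iota> s. ereal (u \<bullet> x)) = robust_value D \<iota> s"
    unfolding robust_value_def
    using finite_SUP_attained[OF recommendations_finite recommendations_nonempty,
        of "\<lambda>x. INF u\<in>U_tilde D \<iota> s. ereal (u \<bullet> x)"] by metis
  have "r \<le> u \<bullet> x" if "u \<in> U_tilde D \<iota> s" for u
    using * INF_lower[OF that, of "\<lambda>u. ereal (u \<bullet> x)"] eq by (metis ereal_less_eq(3) order_trans)
  then show "\<exists>\<alpha> \<beta> \<mu> x. dual_feasible D \<iota> s r \<alpha> \<beta> \<mu> x"
    using dual_feasible_exists[OF x] by blast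
qed

section \<open>The value and the outcomes of the relaxed main problem\<close>

text \<open>For \<open>S = {}\<close> this is \<infinity>, which is why the first main problem is
  unbounded.\<close>

definition relaxed_value :: "(real ^ 'k) set \<Rightarrow> ('k::finite) queries \<Rightarrow> ereal" where
  "relaxed_value S \<iota> = (INF s\<in>S. robust_value D \<iota> s)"

lemma objective_le_relaxed_value: "S \<subseteq> answers \<Longrightarrow> objective D \<iota> \<le> relaxed_value S \<iota>"
  unfolding objective_eq_robust_value relaxed_value_def by (rule INF_superset_mono) auto

lemma main_feasible_iff:
  "(\<exists>\<alpha> \<beta> \<mu> x. main_feasible D S \<tau> \<iota> \<alpha> \<beta> \<mu> x) \<longleftrightarrow>
     \<iota> \<in> query_set D \<and> ereal \<tau> \<le> relaxed_value S \<iota>"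
proof -
  \<comment> \<open>For fixed \<open>\<tau>\<close> and \<open>\<iota>\<close> the blocks are
    independent, so multipliers can be chosen separately for each \<open>s\<close>.\<close>
  have "(\<exists>\<alpha> \<beta> \<mu> x. \<forall>s\<in>S. dual_feasible D \<iota> s \<tau> (\<alpha> s) (\<beta> s) (\<mu> s) (x s)) \<longleftrightarrow>
      (\<forall>s\<in>S. \<exists>\<alpha> \<beta> \<mu> x. dual_feasible D \<iota> s \<tau> \<alpha> \<beta> \<mu> x)"
    by (simp only: bchoice_iff)
  then show ?thesis
    by (simp add: main_feasible_iff_dual_feasible dual_feasible_iff relaxed_value_def le_INF_iff)
qed

text \<open>Cauchy-Schwarz on two bounded sets. An empty \<open>U_tilde\<close> gives \<infinity>,
  which respects the lower bound but not the upper one.\<close>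

lemma robust_value_bounds:
  "\<exists>C. \<forall>(\<iota> :: ('k::finite) queries) s.
     ereal (- C) \<le> robust_value D \<iota> s \<and> (U_tilde D \<iota> s \<noteq> {} \<longrightarrow> robust_value D \<iota> s \<le> ereal C)"
proof -
  obtain A where A: "\<And>u. u \<in> U0 D \<Longrightarrow> norm u \<le> A"
    using U0_bounded unfolding bounded_iff by blast
  obtain B where B: "\<And>x. x \<in> recommendations D \<Longrightarrow> norm x \<le> B"
    using finite_imp_bounded[OF recommendations_finite] unfolding bounded_iff by blast
  have C: "\<bar>u \<bullet> x\<bar> \<le> A * B" if "u \<in> U0 D" "x \<in> recommendations D" for u x
  proof -
    have "\<bar>u \<bullet> x\<bar> \<le> norm u * norm x"
      by (rule Cauchy_Schwarz_ineq2)
    also have "\<dots> \<le> A * B"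
      using A[OF that(1)] B[OF that(2)] norm_ge_zero order_trans by (intro mult_mono) blast+
    finally show ?thesis .
  qed
  show ?thesis
  proof (intro exI[of _ "A * B"] allI conjI impI)
    fix \<iota> :: "'k queries" and s
    obtain x where x: "x \<in> recommendations D"
      using recommendations_nonempty by blast
    then show "ereal (- (A * B)) \<le> robust_value D \<iota> s"
      unfolding robust_value_def
    proof (rule SUP_upper2)
      show "ereal (- (A * B)) \<le> (INF u\<in>U_tilde D \<iota> s. ereal (u \<bullet> x))"
      proof (rule INF_greatest)
        fix u assume "u \<in> U_tilde D \<iota> s"
        then have "u \<in> U0 D"
          by (simp add: U_tilde_def)
        from C[OF this x] show "ereal (- (A * B)) \<le> ereal (u \<bullet> x)"
          by simp
      qed
    qed
  next
    fix \<iota> :: "'k queries" and s assume "U_tilde D \<iota> s \<noteq> {}"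
    then obtain u where u: "u \<in> U_tilde D \<iota> s"
      by blast
    then have "u \<in> U0 D"
      by (simp add: U_tilde_def)
    then show "robust_value D \<iota> s \<le> ereal (A * B)"
      unfolding robust_value_def using C[of u] abs_le_D1
      by (intro SUP_least INF_lower2[OF u]) auto
  qed
qed

text \<open>Excludes an infeasible main problem, an outcome for which \<open>main_result\<close> has
  no rule.\<close>

lemma relaxed_value_not_MInf: "relaxed_value S \<iota> \<noteq> - \<infinity>"
proof -
  obtain C where "\<And>s. ereal (- C) \<le> robust_value D \<iota> s"
    using robust_value_bounds by blast
  then have "ereal (- C) \<le> relaxed_value S \<iota>"
    unfolding relaxed_value_def by (intro INF_greatest)
  then show ?thesis
    by auto
qed

text \<open>For each \<open>\<iota>\<close> the feasible levels are exactly the reals up to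
  \<open>relaxed_value S \<iota>\<close>, so both outcomes say that \<open>\<iota>\<close> maximises
  this value, be it finite or \<infinity>.\<close>

lemma main_result_iff:
  "main_result D S \<tau> \<iota> \<longleftrightarrow>
     \<iota> \<in> query_set D \<and> \<tau> = relaxed_value S \<iota> \<and> (\<forall>\<iota>'\<in>query_set D. relaxed_value S \<iota>' \<le> \<tau>)"
proof
  assume "main_result D S \<tau> \<iota>"
  then show "\<iota> \<in> query_set D \<and> \<tau> = relaxed_value S \<iota> \<and> (\<forall>\<iota>'\<in>query_set D. relaxed_value S \<iota>' \<le> \<tau>)"
  proof cases
    case (solvable t \<alpha> \<beta> \<mu> x)
    then have \<iota>: "\<iota> \<in> query_set D" "ereal t \<le> relaxed_value S \<iota>"
      using main_feasible_iff unfolding main_optimal_def by blast+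
    have le: "relaxed_value S \<iota>' \<le> ereal t" if "\<iota>' \<in> query_set D" for \<iota>'
      unfolding ereal_le_iff_real_le[of "relaxed_value S \<iota>'"]
    proof (intro allI impI)
      fix r assume "ereal r \<le> relaxed_value S \<iota>'"
      then have "\<exists>\<alpha> \<beta> \<mu> x. main_feasible D S r \<iota>' \<alpha> \<beta> \<mu> x"
        using that main_feasible_iff by blast
      then have "r \<le> t"
        using solvable(2) unfolding main_optimal_def by blast
      then show "ereal r \<le> ereal t"
        by simp
    qed
    then show ?thesis
      using \<iota> solvable(1) by (simp add: order.antisym)
  next
    case unbounded
    have "ereal r \<le> relaxed_value S \<iota>" for r
    proof -
      obtain t where "r \<le> t" "\<exists>\<alpha> \<beta> \<mu> x. main_feasible D S t \<iota> \<alpha> \<beta> \<mu> x"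
        using unbounded unfolding main_unbounded_at_def by blast
      then show ?thesis
        using main_feasible_iff by (metis ereal_less_eq(3) order_trans)
    qed
    then have "relaxed_value S \<iota> = \<infinity>"
      by (intro ereal_top)
    then show ?thesis
      using unbounded by simp
  qed
next
  assume *: "\<iota> \<in> query_set D \<and> \<tau> = relaxed_value S \<iota> \<and> (\<forall>\<iota>'\<in>query_set D. relaxed_value S \<iota>' \<le> \<tau>)"
  show "main_result D S \<tau> \<iota>"
  proof (cases \<tau>)
    case (real t)
    then obtain \<alpha> \<beta> \<mu> x where feas: "main_feasible D S t \<iota> \<alpha> \<beta> \<mu> x"
      using * main_feasible_iff[of S t \<iota>] by auto
    have "t' \<le> t" if "main_feasible D S t' \<iota>' \<alpha>' \<beta>' \<mu>' x'" for t' \<iota>' \<alpha>' \<beta>' \<mu>' x'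
      using that * real main_feasible_iff[of S t' \<iota>'] by (metis ereal_less_eq(3) order_trans)
    then have "main_optimal D S t \<iota> \<alpha> \<beta> \<mu> x"
      using feas unfolding main_optimal_def by blast
    then show ?thesis
      unfolding real by (rule main_result.solvable)
  next
    case PInf
    then have "main_unbounded_at D S \<iota>"
      unfolding main_unbounded_at_def using * main_feasible_iff[of S _ \<iota>]
      by (metis ereal_less_eq(1) order_refl)
    moreover from this have "main_unbounded D S"
      unfolding main_unbounded_at_def main_unbounded_def by blast
    ultimately show ?thesis
      unfolding PInf using * by (intro main_result.unbounded) auto
  next
    case MInf
    then show ?thesis
      using * relaxed_value_not_MInf by metis
  qed
qed

lemma main_result_exists:
  assumes "2 \<le> num_items D"
  shows "\<exists>\<tau> \<iota>. main_result D S \<tau> \<iota>"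
proof -
  obtain \<iota> where "\<iota> \<in> query_set D" "relaxed_value S \<iota> = (SUP \<iota>'\<in>query_set D. relaxed_value S \<iota>')"
    by (rule finite_SUP_attained[OF finite_query_set query_set_nonempty[OF assms], of "relaxed_value S"])
  then have "main_result D S (relaxed_value S \<iota>) \<iota>"
    unfolding main_result_iff by (simp add: SUP_upper)
  then show ?thesis
    by blast
qed

section \<open>Attainment and optimal value in the feasibility problem\<close>

text \<open>The set is the projection to \<open>u\<close> of a compact set of pairs
  \<open>(u, \<epsilon>)\<close>.\<close>

lemma compact_U_tilde: "compact (U_tilde D \<iota> (s :: real ^ 'k::finite))"
proof -
  have closed_U0: "closed (U0 D)"
    unfolding U0_def matrix_vector_mul_component
    by (intro closed_Collect_all closed_Collect_le continuous_intros)
  have "compact (noise_set D :: (real ^ 'k) set)"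
    unfolding compact_eq_bounded_closed
  proof
    show "closed (noise_set D :: (real ^ 'k) set)"
      unfolding noise_set_def
      by (intro closed_Collect_conj closed_Collect_all closed_Collect_le continuous_intros)
    have "noise_set D \<subseteq> {0 .. (\<chi> \<kappa>. budget D) :: real ^ 'k}"
    proof
      fix \<epsilon> :: "real ^ 'k" assume \<epsilon>: "\<epsilon> \<in> noise_set D"
      have "\<epsilon> $ \<kappa> \<le> budget D" for \<kappa>
        using member_le_sum[of \<kappa> UNIV "($) \<epsilon>"] \<epsilon> by (auto simp: noise_set_def)
      with \<epsilon> show "\<epsilon> \<in> {0 .. (\<chi> \<kappa>. budget D)}"
        by (simp add: noise_set_def less_eq_vec_def)
    qed
    then show "bounded (noise_set D :: (real ^ 'k) set)"
      by (rule bounded_subset[rotated]) (simp add: interval_cbox_cart[symmetric])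
  qed
  then have "compact (U0 D \<times> noise_set D :: ((real ^ 'j) \<times> (real ^ 'k)) set)"
    using closed_U0 U0_bounded by (intro compact_Times) (simp_all add: compact_eq_bounded_closed)
  moreover have "closed {p. \<forall>\<kappa>. - (snd p $ \<kappa>) \<le> s $ \<kappa> * (fst p \<bullet> qdiff D \<iota> \<kappa>)}"
    by (intro closed_Collect_all closed_Collect_le continuous_intros)
  ultimately have "compact ((U0 D \<times> noise_set D) \<inter>
      {p. \<forall>\<kappa>. - (snd p $ \<kappa>) \<le> s $ \<kappa> * (fst p \<bullet> qdiff D \<iota> \<kappa>)})"
    by (rule compact_Int_closed)
  then have "compact (fst ` ((U0 D \<times> noise_set D) \<inter>
      {p. \<forall>\<kappa>. - (snd p $ \<kappa>) \<le> s $ \<kappa> * (fst p \<bullet> qdiff D \<iota> \<kappa>)}))"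
    by (intro compact_continuous_image continuous_intros)
  also have "fst ` ((U0 D \<times> noise_set D) \<inter>
      {p. \<forall>\<kappa>. - (snd p $ \<kappa>) \<le> s $ \<kappa> * (fst p \<bullet> qdiff D \<iota> \<kappa>)}) = U_tilde D \<iota> s"
    unfolding U_tilde_def by force
  finally show ?thesis .
qed

text \<open>For each sign of \<open>s $ \<kappa>\<close> one of the two big-M constraints has
  right-hand side \<open>- 2 * M\<close> or \<open>2 * M\<close> and is implied; the other has
  right-hand side 0 and is the answer constraint.\<close>

lemma feas_feasible_iff_noise:
  fixes \<iota> :: "('k::finite) queries"
  assumes M: "big_M D \<iota> M"
  shows "feas_feasible D M \<iota> \<theta> s u \<epsilon> \<longleftrightarrow>
     s \<in> answers \<and>
     (\<forall>x\<in>recommendations D.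
        u x \<in> U0 D \<and> \<epsilon> x \<in> noise_set D \<and> u x \<bullet> x \<le> \<theta> \<and>
        (\<forall>\<kappa>. - (\<epsilon> x $ \<kappa>) \<le> s $ \<kappa> * (u x \<bullet> qdiff D \<iota> \<kappa>)))"
proof -
  have "(v \<bullet> qdiff D \<iota> \<kappa> + e $ \<kappa> \<ge> M * (s $ \<kappa> - 1) \<and> v \<bullet> qdiff D \<iota> \<kappa> - e $ \<kappa> \<le> M * (s $ \<kappa> + 1)) \<longleftrightarrow>
      - (e $ \<kappa>) \<le> s $ \<kappa> * (v \<bullet> qdiff D \<iota> \<kappa>)"
    if "s \<in> answers" "v \<in> U0 D" "e \<in> noise_set D" for v e \<kappa>
  proof -
    have "s $ \<kappa> = -1 \<or> s $ \<kappa> = 1"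
      using that(1) by (simp add: answers_def)
    moreover have "v \<bullet> qdiff D \<iota> \<kappa> + e $ \<kappa> \<ge> - 2 * M" "v \<bullet> qdiff D \<iota> \<kappa> - e $ \<kappa> \<le> 2 * M"
      using M that unfolding big_M_def by blast+
    ultimately show ?thesis
      by (auto simp: algebra_simps)
  qed
  then show ?thesis
    unfolding feas_feasible_def by (intro conj_cong ball_cong refl) auto
qed

lemma feas_feasible_iff:
  fixes \<iota> :: "('k::finite) queries"
  assumes M: "big_M D \<iota> M"
  shows "(\<exists>u \<epsilon>. feas_feasible D M \<iota> \<theta> s u \<epsilon>) \<longleftrightarrow> s \<in> answers \<and> robust_value D \<iota> s \<le> ereal \<theta>"
proof -
  have "(\<exists>u \<epsilon>. feas_feasible D M \<iota> \<theta> s u \<epsilon>) \<longleftrightarrow>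
      s \<in> answers \<and> (\<forall>x\<in>recommendations D. \<exists>u\<in>U_tilde D \<iota> s. u \<bullet> x \<le> \<theta>)"
  proof -
    have "(\<forall>x\<in>recommendations D. \<exists>u\<in>U_tilde D \<iota> s. u \<bullet> x \<le> \<theta>) \<longleftrightarrow>
        (\<forall>x\<in>recommendations D. \<exists>u \<epsilon>. u \<in> U0 D \<and> \<epsilon> \<in> noise_set D \<and> u \<bullet> x \<le> \<theta> \<and>
          (\<forall>\<kappa>. - (\<epsilon> $ \<kappa>) \<le> s $ \<kappa> * (u \<bullet> qdiff D \<iota> \<kappa>)))"
      unfolding U_tilde_def by (intro ball_cong refl) blast
    then show ?thesis
      unfolding feas_feasible_iff_noise[OF M] bchoice_iff by blast
  qed
  also have "\<dots> \<longleftrightarrow> s \<in> answers \<and> robust_value D \<iota> s \<le> ereal \<theta>"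
  proof -
    have "(\<exists>u\<in>U_tilde D \<iota> s. u \<bullet> x \<le> \<theta>) \<longleftrightarrow> (INF u\<in>U_tilde D \<iota> s. ereal (u \<bullet> x)) \<le> ereal \<theta>" for x
    proof
      assume "\<exists>u\<in>U_tilde D \<iota> s. u \<bullet> x \<le> \<theta>"
      then show "(INF u\<in>U_tilde D \<iota> s. ereal (u \<bullet> x)) \<le> ereal \<theta>"
        by (auto intro: INF_lower2)
    next
      \<comment> \<open>A real bound rules out an empty \<open>U_tilde\<close>, whose infimum is
        \<infinity>; the minimiser is needed when the infimum equals
        \<open>\<theta>\<close>.\<close>
      assume le: "(INF u\<in>U_tilde D \<iota> s. ereal (u \<bullet> x)) \<le> ereal \<theta>"
      then have "U_tilde D \<iota> s \<noteq> {}"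
        by (auto simp: top_ereal_def)
      moreover have "continuous_on (U_tilde D \<iota> s) (\<lambda>u. u \<bullet> x)"
        by (intro continuous_intros)
      ultimately obtain u where u: "u \<in> U_tilde D \<iota> s" "\<forall>v\<in>U_tilde D \<iota> s. u \<bullet> x \<le> v \<bullet> x"
        using continuous_attains_inf[OF compact_U_tilde] by blast
      then have "ereal (u \<bullet> x) \<le> (INF u\<in>U_tilde D \<iota> s. ereal (u \<bullet> x))"
        by (auto intro: INF_greatest)
      with le have "ereal (u \<bullet> x) \<le> ereal \<theta>"
        by (rule order_trans[rotated])
      with u(1) show "\<exists>u\<in>U_tilde D \<iota> s. u \<bullet> x \<le> \<theta>"
        by auto
    qed
    then show ?thesis
      by (simp add: robust_value_def SUP_le_iff)
  qed
  finally show ?thesis .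
qed

text \<open>A robust value below \<open>\<theta>\<close> would leave room for a smaller feasible
  real. The last claim is what shows that a returned \<open>s\<close> is new.\<close>

lemma feas_optimal_imp:
  fixes \<iota> :: "('k::finite) queries"
  assumes M: "big_M D \<iota> M" and opt: "feas_optimal D M \<iota> \<theta> s u \<epsilon>"
  shows "s \<in> answers" and "ereal \<theta> = objective D \<iota>" and "robust_value D \<iota> s = ereal \<theta>"
proof -
  have s: "s \<in> answers" "robust_value D \<iota> s \<le> ereal \<theta>"
    using opt feas_feasible_iff[OF M] unfolding feas_optimal_def by blast+
  have le: "ereal \<theta> \<le> robust_value D \<iota> s'" if "s' \<in> answers" for s'
  proof (rule ccontr)
    assume "\<not> ereal \<theta> \<le> robust_value D \<iota> s'"
    then have "robust_value D \<iota> s' < ereal \<theta>"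
      by simp
    then obtain r where r: "robust_value D \<iota> s' < ereal r" "r < \<theta>"
      using ereal_dense2 by fastforce
    then have "\<exists>u \<epsilon>. feas_feasible D M \<iota> r s' u \<epsilon>"
      using feas_feasible_iff[OF M] that less_imp_le by blast
    then have "\<theta> \<le> r"
      using opt unfolding feas_optimal_def by blast
    with r(2) show False
      by simp
  qed
  show "s \<in> answers"
    by (fact s)
  show "robust_value D \<iota> s = ereal \<theta>"
    using s le by (simp add: order.antisym)
  then show "ereal \<theta> = objective D \<iota>"
    unfolding objective_eq_robust_value using s le
    by (intro order.antisym) (auto intro: INF_greatest INF_lower2)
qed

text \<open>Any fixed \<open>u\<close> in \<open>U0 D\<close> is consistent with its own truthful
  answers, with zero noise.\<close>

lemma answers_compatible: "\<exists>s\<in>answers. U_tilde D \<iota> s \<noteq> {}"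
proof -
  obtain u where u: "u \<in> U0 D"
    using U0_nonempty by blast
  define s where "s = (\<chi> \<kappa>. if 0 \<le> u \<bullet> qdiff D \<iota> \<kappa> then 1 else (- 1 :: real))"
  have "0 \<in> noise_set D"
    using budget_nonneg by (simp add: noise_set_def)
  moreover have "- ((0 :: real ^ _) $ \<kappa>) \<le> s $ \<kappa> * (u \<bullet> qdiff D \<iota> \<kappa>)" for \<kappa>
    by (simp add: s_def)
  ultimately have "u \<in> U_tilde D \<iota> s"
    using u unfolding U_tilde_def by blast
  moreover have "s \<in> answers"
    by (simp add: s_def answers_def)
  ultimately show ?thesis
    by blast
qed

text \<open>A minimum over finitely many answers is attained, and compatible answers make it
  real.\<close>

lemma feas_optimal_exists:
  fixes \<iota> :: "('k::finite) queries"
  assumes M: "big_M D \<iota> M"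
  shows "\<exists>\<theta> s u \<epsilon>. feas_optimal D M \<iota> \<theta> s u \<epsilon>"
proof -
  obtain s0 where s0: "s0 \<in> answers" "U_tilde D \<iota> s0 \<noteq> {}"
    using answers_compatible by blast
  obtain C where C: "\<And>s. ereal (- C) \<le> robust_value D \<iota> s" "robust_value D \<iota> s0 \<le> ereal C"
    using robust_value_bounds s0(2) by metis
  obtain s where s: "s \<in> answers" and min: "robust_value D \<iota> s = (INF s\<in>answers. robust_value D \<iota> s)"
    using s0(1) by (elim finite_INF_attained[OF finite_answers, of "robust_value D \<iota>", rotated]) blast
  have "robust_value D \<iota> s \<le> ereal C"
    using C(2) INF_lower[OF s0(1), of "robust_value D \<iota>"] min by simp
  with C(1)[of s] obtain \<theta> where \<theta>: "robust_value D \<iota> s = ereal \<theta>"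
    by (cases "robust_value D \<iota> s") auto
  then obtain u \<epsilon> where "feas_feasible D M \<iota> \<theta> s u \<epsilon>"
    using feas_feasible_iff[OF M] s by fastforce
  moreover have "\<theta> \<le> \<theta>'" if "feas_feasible D M \<iota> \<theta>' s' u' \<epsilon>'" for \<theta>' s' u' \<epsilon>'
  proof -
    have s': "s' \<in> answers" "robust_value D \<iota> s' \<le> ereal \<theta>'"
      using feas_feasible_iff[OF M] that by blast+
    have "ereal \<theta> \<le> robust_value D \<iota> s'"
      using INF_lower[OF s'(1), of "robust_value D \<iota>"] min \<theta> by simp
    with s'(2) show ?thesis
      by (meson ereal_less_eq(3) order_trans)
  qed
  ultimately show ?thesis
    unfolding feas_optimal_def by blast
qed

end

subsection \<open>The algorithm\<close>

text \<open>\<open>queries_type\<close> fixes the type \<open>'k\<close>, which does not occur in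
  the types of \<open>D\<close>, \<open>M\<close> and \<open>\<delta>\<close>.\<close>

locale column_constraint_generation = bounded_elicitation D
  for D :: "('j::finite, 'n::finite) elicitation" +
  fixes M \<delta> :: real and queries_type :: "('k::finite) itself"
  assumes items: "2 \<le> num_items D"
    and M: "\<And>\<iota> :: 'k queries. \<iota> \<in> query_set D \<Longrightarrow> big_M D \<iota> M"
    and \<delta>_nonneg: "0 \<le> \<delta>"
begin

text \<open>Without an incumbent the gap is infinite, so the loop cannot be left before an iteration
  has produced queries to return.\<close>

fun invariant :: "'k alg_state \<Rightarrow> bool" where
  "invariant (Loop_Head UB LB S None) \<longleftrightarrow> S \<subseteq> answers \<and> UB = \<infinity> \<and> LB = - \<infinity>"
| "invariant (Loop_Head UB LB S (Some (\<iota>, \<theta>))) \<longleftrightarrow>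
     S \<subseteq> answers \<and> \<iota> \<in> query_set D \<and> LB = ereal \<theta> \<and> ereal \<theta> = objective D \<iota> \<and>
     (SUP \<iota>'\<in>(query_set D :: 'k queries set). objective D \<iota>') \<le> UB"
| "invariant (Main_Solved \<tau> LB S \<iota>) \<longleftrightarrow> S \<subseteq> answers \<and> main_result D S \<tau> \<iota>"
| "invariant (Returned \<iota> \<theta>) \<longleftrightarrow>
     \<iota> \<in> query_set D \<and> ereal \<theta> = objective D \<iota> \<and>
     (SUP \<iota>'\<in>(query_set D :: 'k queries set). objective D \<iota>') \<le> ereal (\<theta> + \<delta>)"

text \<open>When the loop test fails, the only remaining step is the exit; hence the two cases.\<close>

fun rank :: "'k alg_state \<Rightarrow> nat" where
  "rank (Loop_Head UB LB S inc) = (if UB - LB > ereal \<delta> then 3 * card (answers - S) + 3 else 1)"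
| "rank (Main_Solved \<tau> LB S \<iota>) = 3 * card (answers - S) + 2"
| "rank (Returned \<iota> \<theta>) = 0"

lemma invariant_init: "invariant alg_init"
  by (simp add: alg_init_def)

text \<open>With c answers outside \<open>S\<close>, an iteration starts at rank 3c + 3 and passes
  3c + 2. A new answer leads to at most 3(c - 1) + 3 = 3c; otherwise the gap has closed and the rank
  is 1.\<close>

lemma step_preserves_invariant_and_decreases_rank:
  assumes "alg_step D M \<delta> \<sigma> \<sigma>'" "invariant \<sigma>"
  shows "invariant \<sigma>' \<and> rank \<sigma>' < rank \<sigma>"
  using assms
proof cases
  case (solve_main UB LB S \<tau> \<iota> inc)
  with assms(2) have "S \<subseteq> answers"
    by (cases inc) auto
  with solve_main show ?thesis
    by simp
next
  case (solve_feas \<iota> \<theta> s u \<epsilon> \<tau> LB S)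
  let ?S = "if ereal \<theta> < \<tau> then insert s S else S"
  have S: "S \<subseteq> answers" and main: "\<iota> \<in> query_set D" "\<tau> = relaxed_value S \<iota>"
      "\<And>\<iota>'. \<iota>' \<in> query_set D \<Longrightarrow> relaxed_value S \<iota>' \<le> \<tau>"
    using assms(2) solve_feas main_result_iff by auto
  note opt = feas_optimal_imp[OF M[OF main(1)] \<open>feas_optimal D M \<iota> \<theta> s u \<epsilon>\<close>]
  have "(SUP \<iota>'\<in>(query_set D :: 'k queries set). objective D \<iota>') \<le> \<tau>"
    using main(3) objective_le_relaxed_value[OF S] by (intro SUP_least) (blast intro: order_trans)
  then have inv: "invariant \<sigma>'"
    using solve_feas S main(1) opt by simp
  have "rank \<sigma>' < rank \<sigma>"
  proof (cases "ereal \<theta> < \<tau>")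
    case True
    have "s \<notin> S"
    proof
      assume "s \<in> S"
      then have "\<tau> \<le> robust_value D \<iota> s"
        unfolding main(2) relaxed_value_def by (rule INF_lower)
      with True opt(3) show False
        by simp
    qed
    then have "answers - insert s S \<subset> answers - S"
      using opt(1) by blast
    then have "card (answers - insert s S) < card (answers - S)"
      by (intro psubset_card_mono) (simp_all add: finite_answers)
    with True show ?thesis
      using solve_feas by simp
  next
    case False
    \<comment> \<open>\<open>S\<close> has not grown here, so the loop test must end the run: the
      gap is at most 0, hence at most \<open>\<delta>\<close>.\<close>
    then have "\<tau> - ereal \<theta> \<le> ereal \<delta>"
      using \<delta>_nonneg by (cases \<tau>) auto
    with False show ?thesis
      using solve_feas by simp
  qed
  with inv show ?thesis ..
next
  case (exit_loop UB LB S \<iota> \<theta>)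
  then have "UB - ereal \<theta> \<le> ereal \<delta>" "(SUP \<iota>'\<in>(query_set D :: 'k queries set). objective D \<iota>') \<le> UB"
    using assms(2) by auto
  moreover from this(1) have "UB \<le> ereal (\<theta> + \<delta>)"
    by (cases UB) auto
  ultimately have "(SUP \<iota>'\<in>(query_set D :: 'k queries set). objective D \<iota>') \<le> ereal (\<theta> + \<delta>)"
    by (blast intro: order_trans)
  with exit_loop assms(2) show ?thesis
    by simp
qed

section \<open>Termination and near-optimality of the returned queries\<close>

lemma invariant_reachable:
  assumes "(alg_step D M \<delta>)\<^sup>*\<^sup>* alg_init \<sigma>"
  shows "invariant \<sigma>"
  using assms
proof induction
  case (step \<sigma> \<sigma>')
  then show ?case
    using step_preserves_invariant_and_decreases_rank by blast
qed (fact invariant_init)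

lemma terminates:
  "\<nexists>run :: nat \<Rightarrow> 'k alg_state. run 0 = alg_init \<and> (\<forall>n. alg_step D M \<delta> (run n) (run (Suc n)))"
proof
  assume "\<exists>run :: nat \<Rightarrow> 'k alg_state. run 0 = alg_init \<and> (\<forall>n. alg_step D M \<delta> (run n) (run (Suc n)))"
  then obtain run :: "nat \<Rightarrow> 'k alg_state"
    where run: "run 0 = alg_init" "\<And>n. alg_step D M \<delta> (run n) (run (Suc n))"
    by blast
  have inv: "invariant (run n)" for n
  proof (induction n)
    case (Suc n)
    then show ?case
      using run(2) step_preserves_invariant_and_decreases_rank by blast
  qed (simp add: run(1) invariant_init)
  have "rank (run n) + n \<le> rank (run 0)" for n
  proof (induction n)
    case (Suc n)
    then show ?case
      using step_preserves_invariant_and_decreases_rank[OF run(2) inv, of n] by simp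
  qed simp
  from this[of "Suc (rank (run 0))"] show False
    by simp
qed

text \<open>Both subproblems always have an outcome, so every other state satisfying the invariant
  has a successor.\<close>

lemma stuck_imp_Returned:
  assumes "invariant \<sigma>" and stuck: "\<nexists>\<sigma>'. alg_step D M \<delta> \<sigma> \<sigma>'"
  obtains \<iota> \<theta> where "\<sigma> = Returned \<iota> \<theta>"
proof (cases \<sigma>)
  case (Loop_Head UB LB S inc)
  show ?thesis
  proof (cases "UB - LB > ereal \<delta>")
    case True
    obtain \<tau> \<iota> where "main_result D S \<tau> (\<iota> :: 'k queries)"
      using main_result_exists[OF items] by blast
    with True stuck Loop_Head show ?thesis
      using alg_step.solve_main by blast
  next
    case False
    with assms(1) Loop_Head obtain \<iota> \<theta> where "inc = Some (\<iota>, \<theta>)"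
      by (cases inc) auto
    with False stuck Loop_Head show ?thesis
      using alg_step.exit_loop by blast
  qed
next
  case (Main_Solved \<tau> LB S \<iota>)
  then have "\<iota> \<in> query_set D"
    using assms(1) main_result_iff by auto
  then show ?thesis
    using feas_optimal_exists[OF M] stuck Main_Solved alg_step.solve_feas by blast
qed (use that in blast)

lemma Returned_imp_near_optimal:
  fixes \<iota> :: "'k queries"
  assumes "invariant (Returned \<iota> \<theta>)"
  shows "\<bar>(SUP \<iota>'\<in>(query_set D :: 'k queries set). objective D \<iota>') - objective D \<iota>\<bar> \<le> ereal \<delta>"
proof -
  let ?opt = "SUP \<iota>'\<in>(query_set D :: 'k queries set). objective D \<iota>'"
  have obj: "objective D \<iota> = ereal \<theta>" and "?opt \<le> ereal (\<theta> + \<delta>)" and "\<iota> \<in> query_set D"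
    using assms by auto
  \<comment> \<open>Together with the upper bound this makes \<open>?opt\<close> real, so the
    difference below is an ordinary one.\<close>
  moreover from this have "ereal \<theta> \<le> ?opt"
    by (metis SUP_upper)
  ultimately show ?thesis
    by (cases ?opt) auto
qed

end

theorem theorem3:
  fixes D :: "('j::finite, 'n::finite) elicitation" and M \<delta> :: real
  assumes "num_items D \<ge> 2"
    and "U0 D \<noteq> {}" and "aff_dim (U0 D) = int DIM(real ^ 'j)" and "bounded (U0 D)"
    and "budget D \<ge> 0"
    and "recommendations D \<noteq> {}" and "finite (recommendations D)"
    and "\<And>\<iota> :: ('k::finite) queries. \<iota> \<in> query_set D \<Longrightarrow> big_M D \<iota> M"
    and "\<delta> \<ge> 0"
  shows
    "(\<nexists>run :: nat \<Rightarrow> 'k alg_state. run 0 = alg_init \<and> (\<forall>n. alg_step D M \<delta> (run n) (run (Suc n)))) \<and>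
     (\<forall>\<sigma> :: 'k alg_state. (alg_step D M \<delta>)\<^sup>*\<^sup>* alg_init \<sigma> \<and> (\<nexists>\<sigma>'. alg_step D M \<delta> \<sigma> \<sigma>') \<longrightarrow>
        (\<exists>\<iota> \<theta>. \<sigma> = Returned \<iota> \<theta> \<and> \<iota> \<in> query_set D \<and> ereal \<theta> = objective D \<iota> \<and>
           \<bar>(SUP \<iota>'\<in>(query_set D :: 'k queries set). objective D \<iota>') - objective D \<iota>\<bar> \<le> ereal \<delta>))"
proof -
  interpret column_constraint_generation D M \<delta> "TYPE('k)"
    using assms by unfold_locales auto
  show ?thesis
  proof (intro conjI allI impI)
    show "\<nexists>run :: nat \<Rightarrow> 'k alg_state. run 0 = alg_init \<and> (\<forall>n. alg_step D M \<delta> (run n) (run (Suc n)))"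
      by (rule terminates)
  next
    fix \<sigma> :: "'k alg_state"
    assume \<sigma>: "(alg_step D M \<delta>)\<^sup>*\<^sup>* alg_init \<sigma> \<and> (\<nexists>\<sigma>'. alg_step D M \<delta> \<sigma> \<sigma>')"
    then have inv: "invariant \<sigma>"
      using invariant_reachable by blast
    with \<sigma> obtain \<iota> \<theta> where "\<sigma> = Returned \<iota> \<theta>"
      using stuck_imp_Returned by blast
    with inv show "\<exists>\<iota> \<theta>. \<sigma> = Returned \<iota> \<theta> \<and> \<iota> \<in> query_set D \<and> ereal \<theta> = objective D \<iota> \<and>
        \<bar>(SUP \<iota>'\<in>(query_set D :: 'k queries set). objective D \<iota>') - objective D \<iota>\<bar> \<le> ereal \<delta>"
      using Returned_imp_near_optimal by auto
  qed
qed

end
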